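(* Let $\mathcal H^{dm}$ be the Hopf algebra of delta-matroids and let $\alpha(\mathbf a,\mathbf b)=\exp_*(\delta_{\mathbf a})*\exp_*(\delta_{\mathbf b})$ with $\delta_{\mathbf a}=x_1\delta_c+x_2\delta_o+\sqrt{x_1x_2}\,\delta_n$ and $\delta_{\mathbf b}=y_1\delta_c+y_2\delta_o+\sqrt{y_1y_2}\,\delta_n$. Then for every delta-matroid $D$ with ground set $E$, $$\alpha(\mathbf a,\mathbf b)(D)=x_1^{\rho(D)}\,y_2^{|E|-\rho(D)}\,\widetilde R_D\Big(\frac{y_1}{x_1}+1,\frac{x_2}{y_2}+1\Big).$$
   Context: A delta-matroid $D=(E,\mathcal F)$ is a finite set $E$ with a nonempty family $\mathcal F$ of subsets (feasible sets) such that for all $X,Y\in\mathcal F$ and $u\in X\triangle Y$ there is $v\in X\triangle Y$ with $X\triangle\{u,v\}\in\mathcal F$. $e$ is a coloop if it is in every feasible set, a loop if in none. If $e$ is not a coloop, $D\backslash e=(E\setminus e,\{F\in\mathcal F:e\notin F\})$; if $e$ is not a loop, $D/e=(E\setminus e,\{F\setminus e:e\in F\in\mathcal F\})$; if $e$ is a loop or coloop, $D/e=D\backslash e$ (the one that is defined). Direct sum: $(E_1\cup E_2,\{F_1\cup F_2\})$. $\mathcal H^{dm}$ is the free module (over a field of characteristic 0) spanned by isomorphism classes of delta-matroids, graded by $|E|$, with multiplication direct sum, counit $1$ on the empty delta-matroid and $0$ otherwise, and coproduct $\Delta(D)=\sum_{A\subseteq E}D\backslash A^c\otimes D/A$. $\delta_c,\delta_o,\delta_n$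 are the linear maps equal to $1$ respectively on $D_c=(\{e\},\{\{e\}\})$, $D_o=(\{e\},\{\emptyset\})$, $D_n=(\{e\},\{\emptyset,\{e\}\})$ and $0$ on all others. $f*g=m\circ(f\otimes g)\circ\Delta$, $\exp_*(\delta)=\sum_{k\ge0}\delta^{*k}/k!$ with $\delta^{*0}=\varepsilon$. Let $r_{\max}(D)$, $r_{\min}(D)$ be the maximum and minimum cardinality of a feasible set; $\rho(D)=\frac12(r_{\max}(D)+r_{\min}(D))$, and for $A\subseteq E$, $\rho(A)=\rho(D\backslash A^c)$. The 2-variable Bollobás–Riordan polynomial is $\widetilde R_D(x,y)=\sum_{A\subseteq E}(x-1)^{\rho(E)-\rho(A)}(y-1)^{|A|-\rho(A)}$, and $\rho(D)=\rho(E)$. *)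

theory Defs
  imports Complex_Main "HOL-Library.Poly_Mapping"
begin

section \<open>Delta-matroids\<close>

type_synonym 'a set_system = "'a set \<times> 'a set set"

abbreviation ground :: "'a set_system \<Rightarrow> 'a set" where "ground \<equiv> fst"
abbreviation feasible :: "'a set_system \<Rightarrow> 'a set set" where "feasible \<equiv> snd"

definition delta_matroid :: "'a set_system \<Rightarrow> bool" where
  "delta_matroid D \<longleftrightarrow>
     finite (ground D) \<and> feasible D \<noteq> {} \<and> feasible D \<subseteq> Pow (ground D) \<and>
     (\<forall>X\<in>feasible D. \<forall>Y\<in>feasible D. \<forall>u\<in>sym_diff X Y.
        \<exists>v\<in>sym_diff X Y. sym_diff X {u, v} \<in> feasible D)"

definition coloop :: "'a set_system \<Rightarrow> 'a \<Rightarrow> bool" where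
  "coloop D e \<longleftrightarrow> e \<in> ground D \<and> (\<forall>F\<in>feasible D. e \<in> F)"

definition loop :: "'a set_system \<Rightarrow> 'a \<Rightarrow> bool" where
  "loop D e \<longleftrightarrow> e \<in> ground D \<and> (\<forall>F\<in>feasible D. e \<notin> F)"

definition delete :: "'a \<Rightarrow> 'a set_system \<Rightarrow> 'a set_system" where
  "delete e D =
     (if coloop D e then (ground D - {e}, {F - {e} |F. F \<in> feasible D \<and> e \<in> F})
      else (ground D - {e}, {F \<in> feasible D. e \<notin> F}))"

definition contract :: "'a \<Rightarrow> 'a set_system \<Rightarrow> 'a set_system" where
  "contract e D =
     (if loop D e then (ground D - {e}, {F \<in> feasible D. e \<notin> F})
      else (ground D - {e}, {F - {e} |F. F \<in> feasible D \<and> e \<in> F}))"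

text \<open>
  Deletion and contraction of a set remove its elements one at a time. On a delta-matroid the
  result does not depend on the order, so the folds below are well defined there.
\<close>

definition delete_set :: "'a set_system \<Rightarrow> 'a set \<Rightarrow> 'a set_system" where
  "delete_set D A = Finite_Set.fold delete D A"

definition contract_set :: "'a set_system \<Rightarrow> 'a set \<Rightarrow> 'a set_system" where
  "contract_set D A = Finite_Set.fold contract D A"

definition relabel :: "('a \<Rightarrow> 'b) \<Rightarrow> 'a set_system \<Rightarrow> 'b set_system" where
  "relabel f D = (f ` ground D, (`) f ` feasible D)"

definition isomorphic :: "'a set_system \<Rightarrow> 'b set_system \<Rightarrow> bool" where
  "isomorphic D D' \<longleftrightarrow> (\<exists>f. inj_on f (ground D) \<and> relabel f D = D')"

text \<open>Applied below to delta-matroids with disjoint ground sets only.\<close>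

definition direct_sum :: "'a set_system \<Rightarrow> 'a set_system \<Rightarrow> 'a set_system" where
  "direct_sum D D' =
     (ground D \<union> ground D', {F \<union> F' |F F'. F \<in> feasible D \<and> F' \<in> feasible D'})"


section \<open>Isomorphism classes\<close>

text \<open>
  Every delta-matroid, over whatever type, is isomorphic to one whose ground set consists of
  natural numbers. Its isomorphism class is represented by the set of all these.
\<close>

typedef dm_class =
  "{C :: nat set_system set.
      \<exists>D :: nat set_system. delta_matroid D \<and> C = {D'. delta_matroid D' \<and> isomorphic D D'}}"
proof
  have "delta_matroid ({} :: nat set, {{}})"
    by (auto simp: delta_matroid_def)
  then show "{D'. delta_matroid D' \<and> isomorphic ({} :: nat set, {{}}) D'} \<in>
      {C :: nat set_system set.
        \<exists>D :: nat set_system. delta_matroid D \<and> C = {D'. delta_matroid D' \<and> isomorphic D D'}}"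
    by blast
qed

definition dm_class :: "'a set_system \<Rightarrow> dm_class" where
  "dm_class D = Abs_dm_class {D'. delta_matroid D' \<and> isomorphic D D'}"

lemma delta_matroid_feasible_subset: "delta_matroid D \<Longrightarrow> feasible D \<subseteq> Pow (ground D)"
  by (simp add: delta_matroid_def)

lemma isomorphic_relabel: "inj_on f (ground D) \<Longrightarrow> isomorphic D (relabel f D)"
  by (auto simp: isomorphic_def)

lemma isomorphic_trans:
  assumes "isomorphic D D'" and "isomorphic D' D''"
  shows "isomorphic D D''"
proof -
  obtain f g where "inj_on f (ground D)" "relabel f D = D'" "inj_on g (ground D')" "relabel g D' = D''"
    using assms by (auto simp: isomorphic_def)
  then have "inj_on (g \<circ> f) (ground D)" "relabel (g \<circ> f) D = D''"
    by (auto simp: relabel_def comp_inj_on image_image image_comp)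
  then show ?thesis by (auto simp: isomorphic_def)
qed

lemma isomorphic_sym:
  assumes "isomorphic D D'" and "feasible D \<subseteq> Pow (ground D)"
  shows "isomorphic D' D"
proof -
  obtain f where f: "inj_on f (ground D)" "relabel f D = D'"
    using assms(1) by (auto simp: isomorphic_def)
  let ?g = "inv_into (ground D) f"
  have "?g ` f ` F = F" if "F \<in> feasible D" for F
    using that f(1) assms(2) by (intro inv_into_image_cancel) auto
  then have "(`) ?g ` (`) f ` feasible D = feasible D"
    by (simp add: image_image)
  moreover have "?g ` f ` ground D = ground D"
    using f(1) by (intro inv_into_image_cancel) auto
  ultimately have "relabel ?g D' = D"
    using f(2) by (auto simp: relabel_def intro: prod_eqI)
  moreover have "inj_on ?g (ground D')"
    using f(2) by (auto simp: relabel_def inj_on_inv_into)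
  ultimately show ?thesis by (auto simp: isomorphic_def)
qed

lemma delta_matroid_relabel:
  assumes D: "delta_matroid D" and f: "inj_on f (ground D)"
  shows "delta_matroid (relabel f D)"
proof -
  have sub: "X \<subseteq> ground D" if "X \<in> feasible D" for X
    using D that by (auto simp: delta_matroid_def)
  have img: "sym_diff (f ` A) (f ` B) = f ` sym_diff A B" if "A \<subseteq> ground D" "B \<subseteq> ground D" for A B
    using that inj_on_image_set_diff[OF f, of A B] inj_on_image_set_diff[OF f, of B A]
    by (auto simp: image_Un)
  have "\<exists>v\<in>sym_diff (f ` X) (f ` Y). sym_diff (f ` X) {u, v} \<in> feasible (relabel f D)"
    if X: "X \<in> feasible D" and Y: "Y \<in> feasible D" and u: "u \<in> sym_diff (f ` X) (f ` Y)" for X Y u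
  proof -
    obtain u' where u': "u' \<in> sym_diff X Y" "u = f u'"
      using u img[OF sub[OF X] sub[OF Y]] by auto
    obtain v where v: "v \<in> sym_diff X Y" "sym_diff X {u', v} \<in> feasible D"
      using D X Y u'(1) unfolding delta_matroid_def by meson
    have "{u', v} \<subseteq> ground D"
      using u'(1) v(1) sub[OF X] sub[OF Y] by auto
    then have "sym_diff (f ` X) {u, f v} = f ` sym_diff X {u', v}"
      using img[OF sub[OF X], of "{u', v}"] u'(2) by simp
    moreover have "f v \<in> sym_diff (f ` X) (f ` Y)"
      using v(1) img[OF sub[OF X] sub[OF Y]] by auto
    ultimately show ?thesis
      using v(2) by (metis image_eqI relabel_def snd_conv)
  qed
  then have exch: "\<forall>X\<in>feasible (relabel f D). \<forall>Y\<in>feasible (relabel f D). \<forall>u\<in>sym_diff X Y.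
      \<exists>v\<in>sym_diff X Y. sym_diff X {u, v} \<in> feasible (relabel f D)"
    by (simp add: relabel_def)
  have "feasible (relabel f D) \<subseteq> Pow (ground (relabel f D))"
    using sub by (fastforce simp: relabel_def)
  moreover have "finite (ground (relabel f D))" and "feasible (relabel f D) \<noteq> {}"
    using D by (auto simp: delta_matroid_def relabel_def)
  ultimately show ?thesis
    using exch by (subst delta_matroid_def) (intro conjI)
qed

lemma Rep_dm_class_dm_class:
  fixes D :: "'a set_system"
  assumes D: "delta_matroid D"
  shows "Rep_dm_class (dm_class D) = {D'. delta_matroid D' \<and> isomorphic D D'}"
proof -
  obtain f :: "'a \<Rightarrow> nat" where f: "inj_on f (ground D)"
    using D finite_imp_inj_to_nat_seg[of "ground D"] by (auto simp: delta_matroid_def)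
  let ?N = "relabel f D"
  have N: "delta_matroid ?N" "isomorphic D ?N" "isomorphic ?N D"
    subgoal using D f by (rule delta_matroid_relabel)
    subgoal using f by (rule isomorphic_relabel)
    subgoal using isomorphic_relabel[OF f] delta_matroid_feasible_subset[OF D] by (rule isomorphic_sym)
    done
  then have "{D'. delta_matroid D' \<and> isomorphic D D'} =
      {D' :: nat set_system. delta_matroid D' \<and> isomorphic ?N D'}"
    using isomorphic_trans[OF N(2)] isomorphic_trans[OF N(3)] by blast
  then show ?thesis
    unfolding dm_class_def using N(1) by (intro Abs_dm_class_inverse) blast
qed

lemma dm_class_eq_iff:
  fixes D :: "'a set_system" and D' :: "'b set_system"
  assumes "delta_matroid D" and "delta_matroid D'"
  shows "dm_class D = dm_class D' \<longleftrightarrow> isomorphic D D'"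
proof
  assume "isomorphic D D'"
  then have *: "isomorphic D' D"
    using delta_matroid_feasible_subset[OF assms(1)] by (rule isomorphic_sym)
  have "isomorphic D N \<longleftrightarrow> isomorphic D' N" for N :: "nat set_system"
    using isomorphic_trans[OF \<open>isomorphic D D'\<close>] isomorphic_trans[OF *] by blast
  then show "dm_class D = dm_class D'"
    by (simp add: dm_class_def)
next
  assume eq: "dm_class D = dm_class D'"
  obtain f :: "'b \<Rightarrow> nat" where f: "inj_on f (ground D')"
    using assms(2) finite_imp_inj_to_nat_seg[of "ground D'"] by (auto simp: delta_matroid_def)
  have "relabel f D' \<in> Rep_dm_class (dm_class D')"
    using f assms(2) by (simp add: Rep_dm_class_dm_class isomorphic_relabel delta_matroid_relabel)
  then have "isomorphic D (relabel f D')"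
    using assms(1) by (simp add: eq[symmetric] Rep_dm_class_dm_class)
  moreover have "isomorphic (relabel f D') D'"
    using isomorphic_relabel[OF f] delta_matroid_feasible_subset[OF assms(2)]
    by (rule isomorphic_sym)
  ultimately show "isomorphic D D'"
    by (rule isomorphic_trans)
qed

definition representative :: "dm_class \<Rightarrow> nat set_system" where
  "representative c = (SOME D. D \<in> Rep_dm_class c)"


section \<open>The Hopf algebra of delta-matroids\<close>

text \<open>
  \<^typ>\<open>dm_class \<Rightarrow>\<^sub>0 'k\<close> is the free module on the isomorphism classes, and
  \<^typ>\<open>dm_class \<times> dm_class \<Rightarrow>\<^sub>0 'k\<close> is its tensor square, the basis element indexed
  by \<open>(c, d)\<close> being the tensor product of those indexed by \<open>c\<close> and \<open>d\<close>.
\<close>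

abbreviation basis :: "'b \<Rightarrow> ('b \<Rightarrow>\<^sub>0 'k::field_char_0)" where
  "basis b \<equiv> Poly_Mapping.single b 1"

definition lin_ext :: "('b \<Rightarrow> 'k) \<Rightarrow> ('b \<Rightarrow>\<^sub>0 'k::field_char_0) \<Rightarrow> 'k" where
  "lin_ext \<phi> h = (\<Sum>b\<in>Poly_Mapping.keys h. Poly_Mapping.lookup h b * \<phi> b)"

definition lin_ext_free ::
    "('b \<Rightarrow> ('c \<Rightarrow>\<^sub>0 'k)) \<Rightarrow> ('b \<Rightarrow>\<^sub>0 'k::field_char_0) \<Rightarrow> ('c \<Rightarrow>\<^sub>0 'k)" where
  "lin_ext_free \<phi> h =
     (\<Sum>b\<in>Poly_Mapping.keys h. Poly_Mapping.map ((*) (Poly_Mapping.lookup h b)) (\<phi> b))"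

text \<open>
  Product and unit complete the structure; convolution of functionals only uses the coproduct
  and the multiplication of the ground field.
\<close>

definition dm_unit :: "dm_class \<Rightarrow>\<^sub>0 'k::field_char_0" where
  "dm_unit = basis (dm_class ({} :: nat set, {{}}))"

definition dm_product ::
    "(dm_class \<times> dm_class \<Rightarrow>\<^sub>0 'k) \<Rightarrow> (dm_class \<Rightarrow>\<^sub>0 'k::field_char_0)" where
  "dm_product = lin_ext_free (\<lambda>(c, d).
     basis (dm_class (direct_sum (relabel Inl (representative c) :: (nat + nat) set_system)
                                 (relabel Inr (representative d)))))"

definition dm_counit :: "(dm_class \<Rightarrow>\<^sub>0 'k::field_char_0) \<Rightarrow> 'k" where
  "dm_counit = lin_ext (\<lambda>c. if c = dm_class ({} :: nat set, {{}}) then 1 else 0)"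

definition dm_coproduct ::
    "(dm_class \<Rightarrow>\<^sub>0 'k::field_char_0) \<Rightarrow> (dm_class \<times> dm_class \<Rightarrow>\<^sub>0 'k)" where
  "dm_coproduct = lin_ext_free (\<lambda>c. let D = representative c in
     \<Sum>A\<in>Pow (ground D).
       basis (dm_class (delete_set D (ground D - A)), dm_class (contract_set D A)))"


section \<open>Convolution of functionals\<close>

text \<open>For linear \<open>f\<close> and \<open>g\<close> this is the composite of \<open>f \<otimes> g\<close> with multiplication in the field.\<close>

definition mult_tensor ::
    "((dm_class \<Rightarrow>\<^sub>0 'k) \<Rightarrow> 'k) \<Rightarrow> ((dm_class \<Rightarrow>\<^sub>0 'k) \<Rightarrow> 'k) \<Rightarrow>
     (dm_class \<times> dm_class \<Rightarrow>\<^sub>0 'k::field_char_0) \<Rightarrow> 'k" where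
  "mult_tensor f g = lin_ext (\<lambda>(c, d). f (basis c) * g (basis d))"

definition conv ::
    "((dm_class \<Rightarrow>\<^sub>0 'k) \<Rightarrow> 'k) \<Rightarrow> ((dm_class \<Rightarrow>\<^sub>0 'k) \<Rightarrow> 'k) \<Rightarrow>
     (dm_class \<Rightarrow>\<^sub>0 'k::field_char_0) \<Rightarrow> 'k" where
  "conv f g = mult_tensor f g \<circ> dm_coproduct"

primrec conv_power ::
    "((dm_class \<Rightarrow>\<^sub>0 'k) \<Rightarrow> 'k) \<Rightarrow> nat \<Rightarrow> (dm_class \<Rightarrow>\<^sub>0 'k::field_char_0) \<Rightarrow> 'k" where
  "conv_power f 0 = dm_counit"
| "conv_power f (Suc k) = conv f (conv_power f k)"

text \<open>
  If \<open>f\<close> is linear and vanishes on the empty delta-matroid, then its \<open>k\<close>-th convolution power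
  vanishes in degrees below \<open>k\<close>, so that on each argument only finitely many summands are
  nonzero and \<^const>\<open>Sum_any\<close> adds these up.
\<close>

definition conv_exp ::
    "((dm_class \<Rightarrow>\<^sub>0 'k) \<Rightarrow> 'k) \<Rightarrow> (dm_class \<Rightarrow>\<^sub>0 'k::field_char_0) \<Rightarrow> 'k" where
  "conv_exp f h = Sum_any (\<lambda>k. conv_power f k h / fact k)"

definition delta_c :: "(dm_class \<Rightarrow>\<^sub>0 'k::field_char_0) \<Rightarrow> 'k" where
  "delta_c = lin_ext (\<lambda>c. if c = dm_class ({0 :: nat}, {{0}}) then 1 else 0)"

definition delta_o :: "(dm_class \<Rightarrow>\<^sub>0 'k::field_char_0) \<Rightarrow> 'k" where
  "delta_o = lin_ext (\<lambda>c. if c = dm_class ({0 :: nat}, {{}}) then 1 else 0)"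

definition delta_n :: "(dm_class \<Rightarrow>\<^sub>0 'k::field_char_0) \<Rightarrow> 'k" where
  "delta_n = lin_ext (\<lambda>c. if c = dm_class ({0 :: nat}, {{}, {0}}) then 1 else 0)"

text \<open>Here and below, \<open>rt\<close> is the choice of square roots, with \<open>rt x\<close> playing the role of \<open>\<surd>x\<close>.\<close>

definition delta_comb ::
    "('k \<Rightarrow> 'k) \<Rightarrow> 'k \<Rightarrow> 'k \<Rightarrow> (dm_class \<Rightarrow>\<^sub>0 'k::field_char_0) \<Rightarrow> 'k" where
  "delta_comb rt x1 x2 h = x1 * delta_c h + x2 * delta_o h + rt (x1 * x2) * delta_n h"

definition alpha ::
    "('k \<Rightarrow> 'k) \<Rightarrow> 'k \<times> 'k \<Rightarrow> 'k \<times> 'k \<Rightarrow> (dm_class \<Rightarrow>\<^sub>0 'k::field_char_0) \<Rightarrow> 'k" where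
  "alpha rt a b =
     conv (conv_exp (delta_comb rt (fst a) (snd a))) (conv_exp (delta_comb rt (fst b) (snd b)))"


section \<open>The two-variable Bollobas-Riordan polynomial\<close>

definition r_max :: "'a set_system \<Rightarrow> nat" where
  "r_max D = Max (card ` feasible D)"

definition r_min :: "'a set_system \<Rightarrow> nat" where
  "r_min D = Min (card ` feasible D)"

definition rho :: "'a set_system \<Rightarrow> rat" where
  "rho D = (of_nat (r_max D) + of_nat (r_min D)) / 2"

definition rho_set :: "'a set_system \<Rightarrow> 'a set \<Rightarrow> rat" where
  "rho_set D A = rho (delete_set D (ground D - A))"

text \<open>The power \<open>x\<^sup>q\<close> for a half-integer \<open>q\<close>, that is, \<open>(\<surd>x)\<^sup>2\<^sup>q\<close>; the floor is exact.\<close>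

definition half_power :: "('k \<Rightarrow> 'k) \<Rightarrow> 'k::field_char_0 \<Rightarrow> rat \<Rightarrow> 'k" where
  "half_power rt x q = rt x powi \<lfloor>2 * q\<rfloor>"

definition bollobas_riordan ::
    "('k \<Rightarrow> 'k) \<Rightarrow> 'a set_system \<Rightarrow> 'k::field_char_0 \<Rightarrow> 'k \<Rightarrow> 'k" where
  "bollobas_riordan rt D x y =
     (\<Sum>A\<in>Pow (ground D).
        half_power rt (x - 1) (rho_set D (ground D) - rho_set D A) *
        half_power rt (y - 1) (of_nat (card A) - rho_set D A))"

end

(*
  The family of feasible sets of D\A consists of the F - A with |F \<inter> A| minimal, and contraction is
  the dual of deletion. Since a feasible set can be chosen minimal on a set and on a subset of it
  at the same time, this gives, with D * A the twist of D by A,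
    2 \<rho>(A) = r_min(D) + |A| - r_min(D * A),
  and dually for contraction, hence \<rho>(D\A^c) + \<rho>(D/A) = \<rho>(D). So x1^\<rho>(D) x2^(|E| - \<rho>(D)) is
  multiplicative along D\A^c and D/A; on one-element delta-matroids it is the given
  infinitesimal functional, and therefore it is the exponential of that functional.
*)

theory Submission
  imports Defs
begin

section \<open>Finiteness, exchange and minimizers among feasible sets\<close>

lemma delta_matroid_finite: "delta_matroid D \<Longrightarrow> finite (ground D)"
  by (simp add: delta_matroid_def)

lemma delta_matroid_nonempty: "delta_matroid D \<Longrightarrow> feasible D \<noteq> {}"
  by (simp add: delta_matroid_def)

lemma feasible_subset_ground: "delta_matroid D \<Longrightarrow> F \<in> feasible D \<Longrightarrow> F \<subseteq> ground D"
  by (auto simp: delta_matroid_def)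

lemma finite_feasible: "delta_matroid D \<Longrightarrow> F \<in> feasible D \<Longrightarrow> finite F"
  by (meson delta_matroid_finite feasible_subset_ground finite_subset)

lemma finite_feasible_family: "delta_matroid D \<Longrightarrow> finite (feasible D)"
  by (meson delta_matroid_finite delta_matroid_feasible_subset finite_Pow_iff finite_subset)

lemma delta_matroid_exchange:
  assumes "delta_matroid D" "X \<in> feasible D" "Y \<in> feasible D" "u \<in> sym_diff X Y"
  obtains v where "v \<in> sym_diff X Y" "sym_diff X {u, v} \<in> feasible D"
  using assms unfolding delta_matroid_def by meson

lemma ex_least_feasible:
  fixes g :: "'a set \<Rightarrow> nat"
  assumes "delta_matroid D"
  shows "\<exists>F\<in>feasible D. \<forall>G\<in>feasible D. g F \<le> g G"
proof -
  obtain F where "F \<in> feasible D"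
    using delta_matroid_nonempty[OF assms] by blast
  then show ?thesis
    using ex_has_least_nat[of "\<lambda>F. F \<in> feasible D" F g] by blast
qed


section \<open>Deletion of a set\<close>

text \<open>An order-free closed form of iterated deletion: the coloop convention amounts to keeping
  the feasible sets that meet \<open>A\<close> in as few elements as possible.\<close>

definition dm_delete :: "'a set_system \<Rightarrow> 'a set \<Rightarrow> 'a set_system" where
  "dm_delete D A = (ground D - A,
     (\<lambda>F. F - A) ` {F \<in> feasible D. \<forall>G\<in>feasible D. card (F \<inter> A) \<le> card (G \<inter> A)})"

lemma ground_dm_delete [simp]: "ground (dm_delete D A) = ground D - A"
  by (simp add: dm_delete_def)

text \<open>
  A feasible set meeting \<open>C\<close> minimally is moved by exchanges towards one, \<open>Y\<close>, meeting \<open>A\<close>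
  minimally; minimality on \<open>C\<close> forces each exchange to swap an element of \<open>A - Y\<close> for one of
  \<open>C \<inter> Y\<close>.
\<close>

lemma minimal_inter_refine:
  assumes D: "delta_matroid D" and AC: "A \<subseteq> C" and F: "F \<in> feasible D"
    and min: "\<And>G. G \<in> feasible D \<Longrightarrow> card (F \<inter> C) \<le> card (G \<inter> C)"
  obtains F' where "F' \<in> feasible D" "card (F' \<inter> C) = card (F \<inter> C)" "F' - C = F - C"
    "\<And>G. G \<in> feasible D \<Longrightarrow> card (F' \<inter> A) \<le> card (G \<inter> A)"
proof -
  obtain Y where Y: "Y \<in> feasible D" "\<And>G. G \<in> feasible D \<Longrightarrow> card (Y \<inter> A) \<le> card (G \<inter> A)"
    using ex_least_feasible[OF D, of "\<lambda>F. card (F \<inter> A)"] by blast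
  define P where "P F' \<longleftrightarrow> F' \<in> feasible D \<and> card (F' \<inter> C) = card (F \<inter> C) \<and> F' - C = F - C" for F'
  have "P F"
    using F by (simp add: P_def)
  \<comment> \<open>An extremal choice stands in for iterating the exchanges.\<close>
  from ex_has_least_nat[of P, OF this, of "\<lambda>F'. card (F' \<inter> A - Y)"]
  obtain F' where F': "P F'" "\<And>G. P G \<Longrightarrow> card (F' \<inter> A - Y) \<le> card (G \<inter> A - Y)"
    by blast
  have F'D: "F' \<in> feasible D" and fin: "finite F'"
    using F' finite_feasible[OF D] by (auto simp: P_def)
  have "F' \<inter> A \<subseteq> Y"
  proof (rule ccontr)
    assume "\<not> F' \<inter> A \<subseteq> Y"
    then obtain u where u: "u \<in> F'" "u \<in> A" "u \<notin> Y"
      by blast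
    then obtain v where v: "v \<in> sym_diff F' Y" "sym_diff F' {u, v} \<in> feasible D"
      using delta_matroid_exchange[OF D F'D Y(1), of u] by blast
    have le: "card (F' \<inter> C) \<le> card (sym_diff F' {u, v} \<inter> C)"
      using min[OF v(2)] F'(1) by (simp add: P_def)
    \<comment> \<open>Otherwise, in particular if \<open>v = u\<close>, the exchange would only
      remove elements from \<open>F' \<inter> C\<close>, among them \<open>u\<close>.\<close>
    have vC: "v \<notin> F' \<and> v \<in> C"
    proof (rule ccontr)
      assume "\<not> (v \<notin> F' \<and> v \<in> C)"
      then have "sym_diff F' {u, v} \<inter> C \<subset> F' \<inter> C"
        using u AC by auto
      then show False
        using le fin psubset_card_mono[of "F' \<inter> C"] by (meson finite_Int leD)
    qed
    then have "sym_diff F' {u, v} \<inter> C = insert v (F' \<inter> C - {u})"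
      using u AC by auto
    moreover have "u \<in> F' \<inter> C" "v \<notin> F' \<inter> C - {u}"
      using u AC vC by auto
    ultimately have "card (sym_diff F' {u, v} \<inter> C) = card (F' \<inter> C)"
      using fin card_Suc_Diff1[of "F' \<inter> C" u] by simp
    moreover have "sym_diff F' {u, v} - C = F' - C"
      using u AC vC by auto
    ultimately have "P (sym_diff F' {u, v})"
      using F'(1) v(2) by (simp add: P_def)
    moreover have "sym_diff F' {u, v} \<inter> A - Y \<subset> F' \<inter> A - Y"
      using u v(1) vC by auto
    ultimately show False
      using F'(2) fin psubset_card_mono[of "F' \<inter> A - Y"] by (meson finite_Diff finite_Int leD)
  qed
  then have "card (F' \<inter> A) \<le> card (Y \<inter> A)"
    using finite_feasible[OF D Y(1)] by (intro card_mono) auto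
  then show ?thesis
    using that[of F'] F'(1) Y(2) by (auto simp: P_def intro: le_trans)
qed

text \<open>By refinement some feasible set is minimal on \<open>A\<close> and on
  \<open>A \<union> B\<close> at once, so minimizing first on \<open>A\<close> and then on
  \<open>B\<close> attains the minimum on \<open>A \<union> B\<close>.\<close>

lemma dm_delete_dm_delete:
  assumes D: "delta_matroid D" and AB: "A \<inter> B = {}"
  shows "dm_delete (dm_delete D A) B = dm_delete D (A \<union> B)"
proof -
  have split: "card (F \<inter> (A \<union> B)) = card (F \<inter> A) + card (F \<inter> B)" if "F \<in> feasible D" for F
    using finite_feasible[OF D that] AB
    by (subst card_Un_disjoint[symmetric]) (auto simp: Int_Un_distrib)
  have inB: "(F - A) \<inter> B = F \<inter> B" and diff: "(F - A) - B = F - (A \<union> B)" for F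
    using AB by auto
  define M where "M S F \<longleftrightarrow> F \<in> feasible D \<and> (\<forall>G\<in>feasible D. card (F \<inter> S) \<le> card (G \<inter> S))" for S F
  have refine: "\<exists>F'. M A F' \<and> M (A \<union> B) F' \<and> F' - (A \<union> B) = F - (A \<union> B)" if "M (A \<union> B) F" for F
  proof -
    have F: "F \<in> feasible D" "\<And>G. G \<in> feasible D \<Longrightarrow> card (F \<inter> (A \<union> B)) \<le> card (G \<inter> (A \<union> B))"
      using that by (simp_all add: M_def)
    obtain F' where "F' \<in> feasible D" "card (F' \<inter> (A \<union> B)) = card (F \<inter> (A \<union> B))"
        "F' - (A \<union> B) = F - (A \<union> B)" "\<And>G. G \<in> feasible D \<Longrightarrow> card (F' \<inter> A) \<le> card (G \<inter> A)"
      using minimal_inter_refine[OF D _ F, of A] by blast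
    then show ?thesis
      using F(2) by (intro exI[of _ F']) (simp add: M_def)
  qed
  \<comment> \<open>The trace on \<open>A\<close> has constant size over the
    \<open>A\<close>-minimal sets, so comparing them on \<open>B\<close> is the same as comparing
    them on \<open>A \<union> B\<close>; \<open>F1\<close> shows that the two minima are
    compatible.\<close>
  have nested: "M A F \<and> (\<forall>G. M A G \<longrightarrow> card (F \<inter> B) \<le> card (G \<inter> B)) \<longleftrightarrow> M A F \<and> M (A \<union> B) F" for F
  proof -
    obtain F0 where "M (A \<union> B) F0"
      using ex_least_feasible[OF D, of "\<lambda>F. card (F \<inter> (A \<union> B))"] by (auto simp: M_def)
    then obtain F1 where F1: "M A F1" "M (A \<union> B) F1"
      using refine by blast
    have eq: "card (G \<inter> A) = card (F1 \<inter> A)" if "M A G" for G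
      using that F1(1) unfolding M_def by (meson le_antisym)
    show ?thesis
    proof (intro iffI conjI; elim conjE)
      assume F: "M A F" "\<forall>G. M A G \<longrightarrow> card (F \<inter> B) \<le> card (G \<inter> B)"
      then have "card (F \<inter> (A \<union> B)) \<le> card (F1 \<inter> (A \<union> B))"
        using F1 eq[OF F(1)] split by (simp add: M_def)
      then show "M (A \<union> B) F"
        using F1(2) F(1) unfolding M_def by (meson le_trans)
    next
      assume F: "M A F" "M (A \<union> B) F"
      show "\<forall>G. M A G \<longrightarrow> card (F \<inter> B) \<le> card (G \<inter> B)"
      proof (intro allI impI)
        fix G assume G: "M A G"
        then have "card (F \<inter> (A \<union> B)) \<le> card (G \<inter> (A \<union> B))"
          using F(2) by (simp add: M_def)
        then show "card (F \<inter> B) \<le> card (G \<inter> B)"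
          using eq[OF G] eq[OF F(1)] split F(1) G by (simp add: M_def)
      qed
    qed
  qed
  have del: "feasible (dm_delete D S) = (\<lambda>F. F - S) ` {F. M S F}" for S
    by (simp add: dm_delete_def M_def)
  have "feasible (dm_delete (dm_delete D A) B) =
      (\<lambda>F. F - A - B) ` {F. M A F \<and> (\<forall>G. M A G \<longrightarrow> card ((F - A) \<inter> B) \<le> card ((G - A) \<inter> B))}"
    unfolding dm_delete_def[of "dm_delete D A" B] snd_conv del Compr_image_eq by (simp add: image_image)
  also have "\<dots> = (\<lambda>F. F - (A \<union> B)) ` {F. M A F \<and> M (A \<union> B) F}"
    by (simp only: inB nested diff)
  also have "\<dots> = feasible (dm_delete D (A \<union> B))"
  \<comment> \<open>A set minimal on \<open>A \<union> B\<close> may fail to be minimal on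
    \<open>A\<close>, but refinement replaces it by one that is, with the same remainder outside
    \<open>A \<union> B\<close>.\<close>
  proof (unfold del, intro equalityI subsetI)
    fix H assume "H \<in> (\<lambda>F. F - (A \<union> B)) ` {F. M (A \<union> B) F}"
    then obtain F where "M (A \<union> B) F" "H = F - (A \<union> B)"
      by blast
    with refine[of F] show "H \<in> (\<lambda>F. F - (A \<union> B)) ` {F. M A F \<and> M (A \<union> B) F}"
      by (metis (mono_tags, lifting) image_eqI mem_Collect_eq)
  qed blast
  finally show ?thesis
    by (intro prod_eqI) (auto simp: dm_delete_def)
qed

text \<open>The feasible sets that survive all agree on \<open>e\<close>. Hence their symmetric
  differences avoid \<open>e\<close>, and so does the element supplied by the exchange
  axiom.\<close>

lemma delta_matroid_delete:
  assumes D: "delta_matroid D"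
  shows "delta_matroid (delete e D)"
proof (cases "coloop D e")
  case True
  then have F: "e \<in> F" if "F \<in> feasible D" for F
    using that by (simp add: coloop_def)
  have del: "delete e D = (ground D - {e}, (\<lambda>F. F - {e}) ` feasible D)"
    using True F by (auto simp: delete_def)
  have "\<exists>v\<in>sym_diff (X - {e}) (Y - {e}). sym_diff (X - {e}) {u, v} \<in> (\<lambda>F. F - {e}) ` feasible D"
    if X: "X \<in> feasible D" and Y: "Y \<in> feasible D" and u: "u \<in> sym_diff (X - {e}) (Y - {e})" for X Y u
  proof -
    have eq: "sym_diff (X - {e}) (Y - {e}) = sym_diff X Y"
      using F[OF X] F[OF Y] by auto
    then obtain v where v: "v \<in> sym_diff X Y" "sym_diff X {u, v} \<in> feasible D"
      using delta_matroid_exchange[OF D X Y] u by blast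
    moreover have "sym_diff (X - {e}) {u, v} = sym_diff X {u, v} - {e}"
      using u v(1) F[OF X] F[OF Y] by auto
    ultimately show ?thesis
      using eq by blast
  qed
  then show ?thesis
    unfolding del using D by (auto simp: delta_matroid_def)
next
  case False
  have sub: "F \<in> feasible D \<Longrightarrow> F \<subseteq> ground D" for F
    using feasible_subset_ground[OF D] .
  have "\<exists>F\<in>feasible D. e \<notin> F"
    using False sub delta_matroid_nonempty[OF D] by (auto simp: coloop_def)
  moreover have "\<exists>v\<in>sym_diff X Y. sym_diff X {u, v} \<in> {F \<in> feasible D. e \<notin> F}"
    if X: "X \<in> feasible D" "e \<notin> X" and Y: "Y \<in> feasible D" "e \<notin> Y" and u: "u \<in> sym_diff X Y" for X Y u
  proof -
    obtain v where v: "v \<in> sym_diff X Y" "sym_diff X {u, v} \<in> feasible D"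
      using delta_matroid_exchange[OF D X(1) Y(1) u] by blast
    moreover have "e \<notin> sym_diff X {u, v}"
      using X Y u v(1) by auto
    ultimately show ?thesis
      by blast
  qed
  ultimately show ?thesis
    using D False sub unfolding delta_matroid_def delete_def by auto
qed

text \<open>The least size of \<open>F \<inter> {e}\<close> is 1 exactly when \<open>e\<close> is a
  coloop, and 0 otherwise; these are the two cases of single deletion.\<close>

lemma delete_eq_dm_delete:
  assumes D: "delta_matroid D"
  shows "delete e D = dm_delete D {e}"
proof (cases "\<forall>F\<in>feasible D. e \<in> F")
  case True
  then have "coloop D e"
    using feasible_subset_ground[OF D] delta_matroid_nonempty[OF D] by (auto simp: coloop_def)
  moreover have "card (F \<inter> {e}) = 1" if "F \<in> feasible D" for F
    using True that by simp
  ultimately show ?thesis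
    using True by (simp add: delete_def dm_delete_def Setcompr_eq_image cong: conj_cong)
next
  case False
  then obtain F0 where F0: "F0 \<in> feasible D" "card (F0 \<inter> {e}) = 0"
    by auto
  have "(\<forall>G\<in>feasible D. card (F \<inter> {e}) \<le> card (G \<inter> {e})) \<longleftrightarrow> e \<notin> F" for F
    using F0 by (cases "e \<in> F") (auto intro!: bexI[of _ F0])
  moreover have "(\<lambda>F. F - {e}) ` {F \<in> feasible D. e \<notin> F} = {F \<in> feasible D. e \<notin> F}"
    by force
  ultimately show ?thesis
    using False unfolding delete_def dm_delete_def coloop_def by auto
qed

lemma dm_delete_empty [simp]: "dm_delete D {} = D"
  by (simp add: dm_delete_def)

lemma dm_delete_insert:
  assumes "delta_matroid D" "delta_matroid (dm_delete D A)" "x \<notin> A"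
  shows "dm_delete D (insert x A) = delete x (dm_delete D A)"
  using dm_delete_dm_delete[of D A "{x}"] assms by (simp add: delete_eq_dm_delete)

lemma delta_matroid_dm_delete:
  assumes "finite A" "delta_matroid D"
  shows "delta_matroid (dm_delete D A)"
  using assms by (induction A) (simp_all add: dm_delete_insert delta_matroid_delete)

text \<open>Single deletions need not commute on arbitrary set systems, so the fold is handled
  through its graph: starting from a delta-matroid, every order of deletion leads to the same closed
  form.\<close>

lemma fold_graph_delete:
  assumes "fold_graph delete D A y" "delta_matroid D" "finite A"
  shows "y = dm_delete D A"
  using assms
proof (induction rule: fold_graph.induct)
  case (insertI x A y)
  then show ?case
    by (simp add: dm_delete_insert delta_matroid_dm_delete)
qed simp

lemma delete_set_eq_dm_delete:
  assumes "finite A" "delta_matroid D"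
  shows "delete_set D A = dm_delete D A"
proof -
  obtain y where "fold_graph delete D A y"
    using finite_imp_fold_graph[OF assms(1)] by metis
  then have "fold_graph delete D A (dm_delete D A)"
    using fold_graph_delete[OF _ assms(2,1)] by metis
  then have "(THE y. fold_graph delete D A y) = dm_delete D A"
    using fold_graph_delete[OF _ assms(2,1)] by (intro the_equality)
  then show ?thesis
    using assms(1) by (simp add: delete_set_def Finite_Set.fold_def)
qed


section \<open>Twisting and contraction\<close>

text \<open>The twist D * A, or partial dual. Twisting by the whole ground set complements every
  feasible set and gives the dual.\<close>

definition twist :: "'a set \<Rightarrow> 'a set_system \<Rightarrow> 'a set_system" where
  "twist A D = (ground D, (\<lambda>F. sym_diff F A) ` feasible D)"

abbreviation dm_dual :: "'a set_system \<Rightarrow> 'a set_system" where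
  "dm_dual D \<equiv> twist (ground D) D"

lemma ground_twist [simp]: "ground (twist A D) = ground D"
  by (simp add: twist_def)

text \<open>Twisting both sets by \<open>A\<close> does not change their symmetric difference, so
  the exchange axiom carries over.\<close>

lemma delta_matroid_twist:
  assumes D: "delta_matroid D" and A: "A \<subseteq> ground D"
  shows "delta_matroid (twist A D)"
proof -
  have "\<exists>v\<in>sym_diff X' Y'. sym_diff X' {u, v} \<in> feasible (twist A D)"
    if X': "X' \<in> feasible (twist A D)" and Y': "Y' \<in> feasible (twist A D)" and u: "u \<in> sym_diff X' Y'" for X' Y' u
  proof -
    obtain X Y where X: "X \<in> feasible D" "X' = sym_diff X A" and Y: "Y \<in> feasible D" "Y' = sym_diff Y A"
      using X' Y' by (auto simp: twist_def)
    have eq: "sym_diff X' Y' = sym_diff X Y"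
      unfolding X Y by auto
    obtain v where v: "v \<in> sym_diff X Y" "sym_diff X {u, v} \<in> feasible D"
      using delta_matroid_exchange[OF D X(1) Y(1) u[unfolded eq]] by blast
    have "sym_diff X' {u, v} = sym_diff (sym_diff X {u, v}) A"
      unfolding X by auto
    then have "sym_diff X' {u, v} \<in> feasible (twist A D)"
      using v(2) by (simp add: twist_def)
    then show ?thesis
      using v(1) eq by metis
  qed
  moreover have "feasible (twist A D) \<subseteq> Pow (ground (twist A D))"
    using feasible_subset_ground[OF D] A by (fastforce simp: twist_def)
  moreover have "finite (ground (twist A D))" "feasible (twist A D) \<noteq> {}"
    using D by (simp_all add: delta_matroid_def twist_def)
  ultimately show ?thesis
    unfolding delta_matroid_def[of "twist A D"] by blast
qed

lemma twist_twist: "twist A (twist B D) = twist (sym_diff A B) D"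
proof -
  have "sym_diff (sym_diff F B) A = sym_diff F (sym_diff A B)" for F
    by auto
  then show ?thesis
    by (simp add: twist_def image_image)
qed

lemma twist_empty [simp]: "twist {} D = D"
  by (simp add: twist_def)

text \<open>A twist by a set disjoint from \<open>B\<close> fixes all traces on \<open>B\<close>,
  and therefore also which sets are minimal there.\<close>

lemma dm_delete_twist:
  assumes "A \<inter> B = {}"
  shows "dm_delete (twist A D) B = twist A (dm_delete D B)"
proof -
  have *: "sym_diff F A \<inter> B = F \<inter> B" "sym_diff F A - B = sym_diff (F - B) A" for F
    using assms by auto
  show ?thesis
    by (simp add: dm_delete_def twist_def Compr_image_eq image_image *)
qed

text \<open>Complementation swaps loops with coloops, and sets containing \<open>e\<close> with sets
  avoiding it. The outer dual is taken in the smaller ground set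
  \<open>ground D - {e}\<close>.\<close>

lemma contract_eq_dual_delete:
  assumes D: "delta_matroid D" and e: "e \<in> ground D"
  shows "contract e D = dm_dual (delete e (dm_dual D))"
proof -
  have sub: "F \<subseteq> ground D" if "F \<in> feasible D" for F
    using feasible_subset_ground[OF D that] .
  have loop: "coloop (dm_dual D) e \<longleftrightarrow> loop D e"
    using sub by (auto simp: coloop_def loop_def twist_def)
  show ?thesis
  proof (cases "loop D e")
    case True
    then have e: "e \<in> ground D" "\<And>F. F \<in> feasible D \<Longrightarrow> e \<notin> F"
      by (auto simp: loop_def)
    have dual: "{F - {e} |F. F \<in> feasible (dm_dual D) \<and> e \<in> F} =
        (\<lambda>F. sym_diff F (ground D) - {e}) ` {F \<in> feasible D. e \<notin> F}"
      using e by (auto simp: twist_def Setcompr_eq_image)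
    have "sym_diff (sym_diff F (ground D) - {e}) (ground D - {e}) = F" if "e \<notin> F" for F
      using that by auto
    then have "(\<lambda>F. sym_diff F (ground D - {e})) ` {F - {e} |F. F \<in> feasible (dm_dual D) \<and> e \<in> F} =
        {F \<in> feasible D. e \<notin> F}"
      unfolding dual image_image by (simp cong: image_cong_simp)
    then show ?thesis
      using True loop unfolding contract_def delete_def by (simp add: twist_def[of "_ - _"])
  next
    case False
    have "e \<in> sym_diff F (ground D) \<longleftrightarrow> e \<notin> F" for F
      using e by auto
    then have dual: "{F \<in> feasible (dm_dual D). e \<notin> F} =
        (\<lambda>F. sym_diff F (ground D)) ` {F \<in> feasible D. e \<in> F}"
      by (simp add: twist_def Compr_image_eq)
    have "sym_diff (sym_diff F (ground D)) (ground D - {e}) = F - {e}" if "e \<in> F" for F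
      using e that by auto
    then have "(\<lambda>F. sym_diff F (ground D - {e})) ` {F \<in> feasible (dm_dual D). e \<notin> F} =
        {F - {e} |F. F \<in> feasible D \<and> e \<in> F}"
      unfolding dual image_image by (simp cong: image_cong_simp) blast
    then show ?thesis
      using False loop unfolding contract_def delete_def by (simp add: twist_def[of "_ - _"])
  qed
qed


text \<open>Contraction is encoded as the dual of deletion, so that the results on deletion transfer
  to it.\<close>

definition dm_contract :: "'a set_system \<Rightarrow> 'a set \<Rightarrow> 'a set_system" where
  "dm_contract D A = dm_dual (dm_delete (dm_dual D) A)"

lemma ground_dm_contract [simp]: "ground (dm_contract D A) = ground D - A"
  by (simp add: dm_contract_def)

lemma dm_dual_dual: "dm_dual (dm_dual D) = D"
  by (simp add: twist_twist)

lemma delta_matroid_dm_contract: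
  assumes "finite A" "delta_matroid D"
  shows "delta_matroid (dm_contract D A)"
  unfolding dm_contract_def
  by (intro delta_matroid_twist delta_matroid_dm_delete assms order_refl)

text \<open>The dual of each intermediate result is a deletion from the dual of \<open>D\<close>.
  Here \<open>A\<close> has to lie in the ground set, since contracting an element outside it would
  leave no feasible set.\<close>

lemma fold_graph_contract:
  assumes "fold_graph contract D A y" "delta_matroid D" "A \<subseteq> ground D"
  shows "y = dm_contract D A"
  using assms
proof (induction rule: fold_graph.induct)
  case emptyI
  show ?case
    by (simp only: dm_contract_def dm_delete_empty dm_dual_dual)
next
  case (insertI x A y)
  let ?Z = "dm_delete (dm_dual D) A"
  have A: "finite A"
    using insertI by (meson delta_matroid_finite finite_subset insert_subset)
  have D': "delta_matroid (dm_dual D)" and Z: "delta_matroid ?Z"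
    using A insertI.prems(1) by (simp_all add: delta_matroid_twist delta_matroid_dm_delete)
  have y: "y = dm_contract D A"
    using insertI by simp
  then have "contract x y = dm_dual (delete x (dm_dual y))"
    using A insertI by (intro contract_eq_dual_delete) (auto simp: delta_matroid_dm_contract)
  also have "dm_dual y = ?Z"
    unfolding y dm_contract_def by (rule dm_dual_dual)
  also have "delete x ?Z = dm_delete (dm_dual D) (insert x A)"
    using dm_delete_insert[OF D' Z insertI.hyps(1)] by simp
  finally show ?case
    by (simp add: dm_contract_def)
qed

lemma contract_set_eq_dm_contract:
  assumes "A \<subseteq> ground D" "delta_matroid D"
  shows "contract_set D A = dm_contract D A"
proof -
  have A: "finite A"
    using assms delta_matroid_finite finite_subset by blast
  obtain y where "fold_graph contract D A y"
    using finite_imp_fold_graph[OF A] by metis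
  then have "fold_graph contract D A (dm_contract D A)"
    using fold_graph_contract[OF _ assms(2,1)] by metis
  then have "(THE y. fold_graph contract D A y) = dm_contract D A"
    using fold_graph_contract[OF _ assms(2,1)] by (intro the_equality)
  then show ?thesis
    using A by (simp add: contract_set_def Finite_Set.fold_def)
qed


section \<open>Additivity of the rank\<close>

text \<open>Twice \<open>\<rho>(D)\<close>, as a natural number.\<close>

definition rank2 :: "'a set_system \<Rightarrow> nat" where
  "rank2 D = r_max D + r_min D"

lemma r_min_eqI:
  assumes "delta_matroid D" "F \<in> feasible D" "\<And>G. G \<in> feasible D \<Longrightarrow> card F \<le> card G"
  shows "r_min D = card F"
  unfolding r_min_def using assms finite_feasible_family[OF assms(1)] by (intro Min_eqI) auto

lemma r_max_eqI:
  assumes "delta_matroid D" "F \<in> feasible D" "\<And>G. G \<in> feasible D \<Longrightarrow> card G \<le> card F"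
  shows "r_max D = card F"
  unfolding r_max_def using assms finite_feasible_family[OF assms(1)] by (intro Max_eqI) auto

text \<open>The complement of a largest feasible set is a smallest feasible set of the dual.\<close>

lemma r_max_plus_r_min_dual:
  assumes D: "delta_matroid D"
  shows "r_max D + r_min (dm_dual D) = card (ground D)"
proof -
  have dual: "feasible (dm_dual D) = (\<lambda>F. ground D - F) ` feasible D"
    unfolding twist_def snd_conv using feasible_subset_ground[OF D] by (intro image_cong) auto
  have compl: "card F + card (ground D - F) = card (ground D)" if "F \<in> feasible D" for F
    using card_mono[of "ground D" F] card_Diff_subset[of F "ground D"] feasible_subset_ground[OF D that]
      finite_feasible[OF D that] delta_matroid_finite[OF D] by simp
  obtain F where F: "F \<in> feasible D" "\<And>G. G \<in> feasible D \<Longrightarrow> card (ground D - F) \<le> card (ground D - G)"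
    using ex_least_feasible[OF D, of "\<lambda>F. card (ground D - F)"] by blast
  have "r_min (dm_dual D) = card (ground D - F)"
    using F D by (intro r_min_eqI delta_matroid_twist) (auto simp: dual)
  moreover have "card G \<le> card F" if "G \<in> feasible D" for G
    using F(2)[OF that] compl[OF that] compl[OF F(1)] by simp
  then have "r_max D = card F"
    using F(1) D by (intro r_max_eqI)
  ultimately show ?thesis
    using compl[OF F(1)] by simp
qed

lemma rank2_dual:
  assumes D: "delta_matroid D"
  shows "rank2 (dm_dual D) + rank2 D = 2 * card (ground D)"
  using r_max_plus_r_min_dual[OF D]
    r_max_plus_r_min_dual[OF delta_matroid_twist[OF D order_refl], unfolded dm_dual_dual]
  by (simp add: rank2_def)

lemma rank2_le:
  assumes D: "delta_matroid D"
  shows "rank2 D \<le> 2 * card (ground D)"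
  using rank2_dual[OF D] by simp

text \<open>A feasible set of least cardinality can be chosen minimal on \<open>B\<close> as well;
  deleting \<open>B\<close> then removes from it exactly the minimal number of elements,
  \<open>card (F \<inter> B)\<close>.\<close>

lemma r_min_dm_delete:
  assumes D: "delta_matroid D" and B: "B \<subseteq> ground D" and F: "F \<in> feasible D"
    and min: "\<And>G. G \<in> feasible D \<Longrightarrow> card (F \<inter> B) \<le> card (G \<inter> B)"
  shows "r_min (dm_delete D B) + card (F \<inter> B) = r_min D"
proof -
  have ground: "G \<inter> ground D = G" if "G \<in> feasible D" for G
    using feasible_subset_ground[OF D that] by blast
  obtain F0 where F0: "F0 \<in> feasible D" "\<And>G. G \<in> feasible D \<Longrightarrow> card F0 \<le> card G"
    using ex_least_feasible[OF D, of card] by blast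
  \<comment> \<open>Refinement with the whole ground set as the larger set, where a trace is the
    feasible set itself.\<close>
  then obtain F1 where F1: "F1 \<in> feasible D" "card F1 = card F0"
      "\<And>G. G \<in> feasible D \<Longrightarrow> card (F1 \<inter> B) \<le> card (G \<inter> B)"
    using minimal_inter_refine[OF D B F0(1)] by (metis ground)
  have split: "card G = card (G - B) + card (G \<inter> B)" if "G \<in> feasible D" for G
    using finite_feasible[OF D that] card_Diff_subset_Int[of G B] card_mono[of G "G \<inter> B"] by simp
  have "r_min D = card F1"
    using F1(1,2) F0(2) by (intro r_min_eqI D) simp_all
  moreover have "card (F1 \<inter> B) = card (F \<inter> B)"
    using F1(1,3) F min by (meson le_antisym)
  moreover have "r_min (dm_delete D B) = card (F1 - B)"
  proof (rule r_min_eqI)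
    show "delta_matroid (dm_delete D B)"
      using D B delta_matroid_finite finite_subset by (blast intro: delta_matroid_dm_delete)
    show "F1 - B \<in> feasible (dm_delete D B)"
      using F1 by (auto simp: dm_delete_def)
    fix H assume "H \<in> feasible (dm_delete D B)"
    then obtain G where G: "G \<in> feasible D" "H = G - B" "card (G \<inter> B) \<le> card (F1 \<inter> B)"
      using F1(1) by (auto simp: dm_delete_def)
    then show "card (F1 - B) \<le> card H"
      using split[OF G(1)] split[OF F1(1)] F0(2)[OF G(1)] F1(2) by simp
  qed
  ultimately show ?thesis
    using split[OF F1(1)] by simp
qed

text \<open>Let m be the least trace size on the complement of \<open>A\<close>. Deleting this
  complement lowers \<open>r_min\<close> by m, both for D and for D * A, whose deletion is the dual
  of the restriction. Duality turns the second \<open>r_min\<close> into \<open>r_max\<close>, and m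
  cancels.\<close>

lemma rank2_dm_delete:
  assumes D: "delta_matroid D" and A: "A \<subseteq> ground D"
  shows "rank2 (dm_delete D (ground D - A)) + r_min (twist A D) = r_min D + card A"
proof -
  let ?B = "ground D - A"
  let ?D' = "dm_delete D ?B"
  have ground: "ground ?D' = A"
    using A by auto
  have D': "delta_matroid ?D'"
    using D delta_matroid_finite by (blast intro: delta_matroid_dm_delete)
  obtain F where F: "F \<in> feasible D" "\<And>G. G \<in> feasible D \<Longrightarrow> card (F \<inter> ?B) \<le> card (G \<inter> ?B)"
    using ex_least_feasible[OF D, of "\<lambda>F. card (F \<inter> ?B)"] by blast
  have twB: "sym_diff G A \<inter> ?B = G \<inter> ?B" for G
    by auto
  have "dm_delete (twist A D) ?B = dm_dual ?D'"
    unfolding ground by (rule dm_delete_twist) blast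
  moreover have "r_min (dm_delete (twist A D) ?B) + card (sym_diff F A \<inter> ?B) = r_min (twist A D)"
    using F by (intro r_min_dm_delete delta_matroid_twist D A) (auto simp: twist_def twB)
  ultimately have "r_min (dm_dual ?D') + card (F \<inter> ?B) = r_min (twist A D)"
    by (simp only: twB)
  moreover have "r_min ?D' + card (F \<inter> ?B) = r_min D"
    using F by (intro r_min_dm_delete D) auto
  ultimately show ?thesis
    using r_max_plus_r_min_dual[OF D'] unfolding ground rank2_def by linarith
qed

text \<open>This is the deletion formula for the dual and the complement of \<open>A\<close>:
  twisting the dual by that complement gives D * A again.\<close>

lemma rank2_dm_contract:
  assumes D: "delta_matroid D" and A: "A \<subseteq> ground D"
  shows "rank2 (dm_contract D A) + r_min (dm_dual D) = card (ground D - A) + r_min (twist A D)"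
proof -
  let ?B = "ground D - A"
  have B: "ground D - ?B = A" and "sym_diff ?B (ground D) = A"
    using A by auto
  then have tw: "twist ?B (dm_dual D) = twist A D"
    by (simp only: twist_twist)
  have "finite A"
    using A D delta_matroid_finite finite_subset by blast
  then have "delta_matroid (dm_delete (dm_dual D) A)"
    using D by (simp add: delta_matroid_dm_delete delta_matroid_twist)
  from rank2_dual[OF this] have "rank2 (dm_contract D A) + rank2 (dm_delete (dm_dual D) A) = 2 * card ?B"
    by (simp add: dm_contract_def)
  moreover have "rank2 (dm_delete (dm_dual D) A) + r_min (twist A D) = r_min (dm_dual D) + card ?B"
    using rank2_dm_delete[OF delta_matroid_twist[OF D order_refl], of ?B] by (simp add: tw B)
  ultimately show ?thesis
    by linarith
qed

text \<open>On adding the formulas for deletion and contraction, \<open>r_min (twist A D)\<close>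
  cancels, and \<open>card (ground D) - r_min (dm_dual D)\<close> is \<open>r_max D\<close>.\<close>

lemma rank2_additive:
  assumes D: "delta_matroid D" and A: "A \<subseteq> ground D"
  shows "rank2 (dm_delete D (ground D - A)) + rank2 (dm_contract D A) = rank2 D"
proof -
  have "card A + card (ground D - A) = card (ground D)"
    using A delta_matroid_finite[OF D] by (simp add: card_Diff_subset card_mono finite_subset)
  then show ?thesis
    using rank2_dm_delete[OF assms] rank2_dm_contract[OF assms] r_max_plus_r_min_dual[OF D]
    unfolding rank2_def by linarith
qed


section \<open>Relabelling\<close>

lemma ground_relabel [simp]: "ground (relabel f D) = f ` ground D"
  by (simp add: relabel_def)

lemma relabel_twist:
  assumes D: "delta_matroid D" and f: "inj_on f (ground D)" and A: "A \<subseteq> ground D"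
  shows "relabel f (twist A D) = twist (f ` A) (relabel f D)"
proof -
  have "f ` sym_diff F A = sym_diff (f ` F) (f ` A)" if "F \<in> feasible D" for F
    using inj_on_image_set_diff[OF f, of F A] inj_on_image_set_diff[OF f, of A F]
      feasible_subset_ground[OF D that] A by (auto simp: image_Un)
  then show ?thesis
    by (simp add: relabel_def twist_def image_image)
qed

lemma relabel_dm_delete:
  assumes D: "delta_matroid D" and f: "inj_on f (ground D)" and A: "A \<subseteq> ground D"
  shows "relabel f (dm_delete D A) = dm_delete (relabel f D) (f ` A)"
proof -
  have diff: "f ` (F - A) = f ` F - f ` A" if "F \<in> feasible D" for F
    using feasible_subset_ground[OF D that] A by (intro inj_on_image_set_diff[OF f]) auto
  have "f ` (F \<inter> A) = f ` F \<inter> f ` A" if "F \<in> feasible D" for F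
    using feasible_subset_ground[OF D that] A by (intro inj_on_image_Int[OF f]) auto
  moreover have "card (f ` (F \<inter> A)) = card (F \<inter> A)" for F
    using A by (intro card_image inj_on_subset[OF f]) auto
  ultimately have card: "card (f ` F \<inter> f ` A) = card (F \<inter> A)" if "F \<in> feasible D" for F
    using that by metis
  have "f ` (ground D - A) = f ` ground D - f ` A"
    using A by (intro inj_on_image_set_diff[OF f]) auto
  then show ?thesis
    by (simp add: relabel_def dm_delete_def image_image Compr_image_eq diff card cong: conj_cong)
qed

lemma relabel_dm_contract:
  assumes D: "delta_matroid D" and f: "inj_on f (ground D)" and A: "A \<subseteq> ground D"
  shows "relabel f (dm_contract D A) = dm_contract (relabel f D) (f ` A)"
proof -
  have fin: "finite A"
    using A D delta_matroid_finite finite_subset by blast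
  have dual: "delta_matroid (dm_dual D)"
    using D by (simp add: delta_matroid_twist)
  have "relabel f (dm_contract D A) =
      twist (f ` (ground D - A)) (relabel f (dm_delete (dm_dual D) A))"
    using fin dual inj_on_subset[OF f, of "ground D - A"] unfolding dm_contract_def
    by (subst relabel_twist) (auto simp: delta_matroid_dm_delete)
  also have "f ` (ground D - A) = f ` ground D - f ` A"
    using A by (intro inj_on_image_set_diff[OF f]) auto
  also have "relabel f (dm_delete (dm_dual D) A) = dm_delete (dm_dual (relabel f D)) (f ` A)"
    using D dual f A by (simp add: relabel_dm_delete relabel_twist)
  finally show ?thesis
    by (simp add: dm_contract_def)
qed

lemma dm_class_relabel:
  assumes "delta_matroid D" "inj_on f (ground D)"
  shows "dm_class (relabel f D) = dm_class D"
  using assms isomorphic_relabel[OF assms(2)]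
  by (metis delta_matroid_relabel dm_class_eq_iff)

text \<open>The coproduct is computed on a chosen representative; this relabelling carries the
  computation back to \<open>D\<close>.\<close>

lemma representative_dm_class:
  fixes D :: "'a set_system"
  assumes D: "delta_matroid D"
  obtains f where "inj_on f (ground D)" "representative (dm_class D) = relabel f D"
proof -
  \<comment> \<open>Copying \<open>D\<close> into the natural numbers shows that the class is
    inhabited, so that the choice is meaningful.\<close>
  obtain g :: "'a \<Rightarrow> nat" where g: "inj_on g (ground D)"
    using delta_matroid_finite[OF D] finite_imp_inj_to_nat_seg by blast
  have "relabel g D \<in> Rep_dm_class (dm_class D)"
    using D g by (simp add: Rep_dm_class_dm_class delta_matroid_relabel isomorphic_relabel)
  then have "representative (dm_class D) \<in> Rep_dm_class (dm_class D)"
    unfolding representative_def by (rule someI)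
  then show ?thesis
    using D that by (auto simp: Rep_dm_class_dm_class isomorphic_def)
qed


section \<open>Convolution on basis elements\<close>

lemma lin_ext_basis [simp]: "lin_ext \<phi> (basis b) = \<phi> b"
  by (simp add: lin_ext_def)

lemma lin_ext_free_basis [simp]: "lin_ext_free \<phi> (basis b) = \<phi> b"
  by (simp add: lin_ext_free_def poly_mapping_eq_iff fun_eq_iff Poly_Mapping.map.rep_eq when_def)

text \<open>Cancellation can make the support of a sum smaller than the union of the supports;
  additivity needs a common index set.\<close>

lemma lin_ext_superset:
  assumes "finite S" "Poly_Mapping.keys h \<subseteq> S"
  shows "lin_ext \<phi> h = (\<Sum>b\<in>S. Poly_Mapping.lookup h b * \<phi> b)"
  unfolding lin_ext_def using assms by (intro sum.mono_neutral_left) (auto simp: in_keys_iff)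

lemma lin_ext_add: "lin_ext \<phi> (g + h) = lin_ext \<phi> g + lin_ext \<phi> h"
proof -
  let ?S = "Poly_Mapping.keys g \<union> Poly_Mapping.keys h"
  have "Poly_Mapping.keys (g + h) \<subseteq> ?S"
    by (rule Poly_Mapping.keys_add)
  then show ?thesis
    by (simp add: lin_ext_superset[of ?S] lookup_add distrib_right sum.distrib)
qed

lemma lin_ext_sum: "lin_ext \<phi> (\<Sum>i\<in>I. h i) = (\<Sum>i\<in>I. lin_ext \<phi> (h i))"
proof (induction I rule: infinite_finite_induct)
  case (insert i I)
  then show ?case
    by (simp add: lin_ext_add)
qed (simp_all add: lin_ext_def)

text \<open>Minors of the representative are relabelled minors of \<open>D\<close> and have the same
  classes, so the coproduct can be read off from \<open>D\<close> itself, over any type.\<close>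

lemma conv_basis:
  fixes D :: "'a set_system"
  assumes D: "delta_matroid D"
  shows "conv f g (basis (dm_class D)) = (\<Sum>A\<in>Pow (ground D).
      f (basis (dm_class (dm_delete D (ground D - A)))) * g (basis (dm_class (dm_contract D A))))"
proof -
  obtain h where h: "inj_on h (ground D)" and R: "representative (dm_class D) = relabel h D"
    using representative_dm_class[OF D] .
  have D': "delta_matroid (relabel h D)"
    by (rule delta_matroid_relabel[OF D h])
  have del: "dm_class (delete_set (relabel h D) (h ` ground D - h ` A)) =
      dm_class (dm_delete D (ground D - A))"
    and con: "dm_class (contract_set (relabel h D) (h ` A)) = dm_class (dm_contract D A)"
    if A: "A \<subseteq> ground D" for A
  proof -
    have diff: "h ` ground D - h ` A = h ` (ground D - A)"
      using A by (intro inj_on_image_set_diff[OF h, symmetric]) auto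
    have fin: "finite (ground D - A)" "finite A"
      using A delta_matroid_finite[OF D] finite_subset by auto
    have "delete_set (relabel h D) (h ` ground D - h ` A) = relabel h (dm_delete D (ground D - A))"
      unfolding diff using fin D' by (simp add: delete_set_eq_dm_delete relabel_dm_delete[OF D h])
    then show "dm_class (delete_set (relabel h D) (h ` ground D - h ` A)) =
        dm_class (dm_delete D (ground D - A))"
      using fin D inj_on_subset[OF h, of A] A
      by (simp add: dm_class_relabel delta_matroid_dm_delete double_diff)
    have "contract_set (relabel h D) (h ` A) = relabel h (dm_contract D A)"
      using A D' by (simp add: contract_set_eq_dm_contract relabel_dm_contract[OF D h] image_mono)
    then show "dm_class (contract_set (relabel h D) (h ` A)) = dm_class (dm_contract D A)"
      using fin D inj_on_subset[OF h, of "ground D - A"]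
      by (simp add: dm_class_relabel delta_matroid_dm_contract)
  qed
  have "conv f g (basis (dm_class D)) = (\<Sum>A\<in>Pow (h ` ground D).
      f (basis (dm_class (delete_set (relabel h D) (h ` ground D - A)))) *
      g (basis (dm_class (contract_set (relabel h D) A))))"
    by (simp add: conv_def dm_coproduct_def mult_tensor_def R Let_def lin_ext_sum)
  also have "\<dots> = (\<Sum>A\<in>Pow (ground D).
      f (basis (dm_class (delete_set (relabel h D) (h ` ground D - h ` A)))) *
      g (basis (dm_class (contract_set (relabel h D) (h ` A)))))"
    using inj_on_image_Pow[OF h]
    by (subst image_Pow_surj[OF refl, symmetric]) (simp add: sum.reindex)
  also have "\<dots> = (\<Sum>A\<in>Pow (ground D).
      f (basis (dm_class (dm_delete D (ground D - A)))) * g (basis (dm_class (dm_contract D A))))"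
    by (intro sum.cong) (simp_all add: del con)
  finally show ?thesis .
qed


section \<open>The weight\<close>

text \<open>For s = sqrt(x1) and t = sqrt(x2) this is x1^\<rho>(D) x2^(|E| - \<rho>(D)); doubling
  makes the exponents natural numbers. By \<open>rank2_le\<close> the subtraction is not truncated
  on delta-matroids.\<close>

definition weight :: "'k::field_char_0 \<Rightarrow> 'k \<Rightarrow> 'a set_system \<Rightarrow> 'k" where
  "weight s t D = s ^ rank2 D * t ^ (2 * card (ground D) - rank2 D)"

lemma weight_multiplicative:
  assumes D: "delta_matroid D" and A: "A \<subseteq> ground D"
  shows "weight s t (dm_delete D (ground D - A)) * weight s t (dm_contract D A) = weight s t D"
proof -
  have fin: "finite A" "finite (ground D)"
    using A delta_matroid_finite[OF D] finite_subset by auto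
  have "rank2 (dm_delete D (ground D - A)) \<le> 2 * card A" "rank2 (dm_contract D A) \<le> 2 * card (ground D - A)"
    using rank2_le[of "dm_delete D (ground D - A)"] rank2_le[of "dm_contract D A"] fin D A
    by (simp_all add: delta_matroid_dm_delete delta_matroid_dm_contract double_diff)
  moreover have "card A + card (ground D - A) = card (ground D)"
    using A fin by (simp add: card_Diff_subset card_mono)
  ultimately have "2 * card (ground D) - rank2 D = (2 * card A - rank2 (dm_delete D (ground D - A))) +
      (2 * card (ground D - A) - rank2 (dm_contract D A))"
    using rank2_additive[OF D A] by linarith
  then show ?thesis
    using A by (simp add: weight_def rank2_additive[OF D A, symmetric] power_add double_diff)
qed

text \<open>The set of feasible cardinalities is an isomorphism invariant that separates the three
  one-element delta-matroids.\<close>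

lemma dm_class_eq_singletonD:
  assumes D: "delta_matroid D" "delta_matroid ({0 :: nat}, \<F>)"
    and "dm_class D = dm_class ({0 :: nat}, \<F>)"
  shows "card (ground D) = 1 \<and> card ` feasible D = card ` \<F>"
proof -
  obtain f where f: "inj_on f (ground D)" "relabel f D = ({0}, \<F>)"
    using assms dm_class_eq_iff[OF D] by (auto simp: isomorphic_def)
  have "card (f ` F) = card F" if "F \<in> feasible D" for F
    using feasible_subset_ground[OF D(1) that] by (intro card_image inj_on_subset[OF f(1)])
  then have "card ` \<F> = card ` feasible D"
    using f(2) by (auto simp: relabel_def image_image)
  moreover have "card (ground D) = 1"
    using f card_image[OF f(1)] by (simp add: relabel_def)
  ultimately show ?thesis
    by simp
qed

text \<open>On D_c, D_o and D_n the doubled rank is 2, 0 and 1, so the weights are s^2, t^2 and s t,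
  which are the three coefficients.\<close>

lemma delta_comb_basis:
  fixes D :: "'a set_system"
  assumes D: "delta_matroid D"
    and rt: "rt x1 ^ 2 = x1" "rt x2 ^ 2 = x2" "rt (x1 * x2) = rt x1 * rt x2"
  shows "delta_comb rt x1 x2 (basis (dm_class D)) =
    (if card (ground D) = 1 then weight (rt x1) (rt x2) D else 0)"
proof -
  have dm: "delta_matroid ({0 :: nat}, {{0}})" "delta_matroid ({0 :: nat}, {{}})"
      "delta_matroid ({0 :: nat}, {{}, {0}})"
    by (auto simp: delta_matroid_def)
  note cls = dm[THEN dm_class_eq_singletonD[OF D]]
  have comb: "delta_comb rt x1 x2 (basis (dm_class D)) =
      x1 * (if dm_class D = dm_class ({0 :: nat}, {{0}}) then 1 else 0) +
      x2 * (if dm_class D = dm_class ({0 :: nat}, {{}}) then 1 else 0) +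
      rt (x1 * x2) * (if dm_class D = dm_class ({0 :: nat}, {{}, {0}}) then 1 else 0)"
    by (simp add: delta_comb_def delta_c_def delta_o_def delta_n_def)
  show ?thesis
  proof (cases "card (ground D) = 1")
    case False
    then show ?thesis
      using cls unfolding comb by auto
  next
    case True
    then obtain e where e: "ground D = {e}"
      by (auto simp: card_1_singleton_iff)
    have "feasible D \<subseteq> {{}, {e}}" "feasible D \<noteq> {}"
      using feasible_subset_ground[OF D] delta_matroid_nonempty[OF D] by (auto simp: e)
    then consider "feasible D = {{e}}" | "feasible D = {{}}" | "feasible D = {{}, {e}}"
      by blast
    then show ?thesis
    proof cases
      case 1
      \<comment> \<open>The constant map 0 is injective on a one-element ground set and serves as
        the isomorphism.\<close>
      have "dm_class D = dm_class ({0 :: nat}, {{0}})"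
        using dm_class_relabel[OF D, of "\<lambda>_. 0 :: nat"] 1 e by (simp add: relabel_def)
      moreover have "dm_class D \<noteq> dm_class ({0 :: nat}, {{}})" "dm_class D \<noteq> dm_class ({0 :: nat}, {{}, {0}})"
        using cls 1 by auto
      ultimately show ?thesis
        unfolding comb using rt 1 e by (simp add: weight_def rank2_def r_max_def r_min_def numeral_2_eq_2)
    next
      case 2
      have "dm_class D = dm_class ({0 :: nat}, {{}})"
        using dm_class_relabel[OF D, of "\<lambda>_. 0 :: nat"] 2 e by (simp add: relabel_def)
      moreover have "dm_class D \<noteq> dm_class ({0 :: nat}, {{0}})" "dm_class D \<noteq> dm_class ({0 :: nat}, {{}, {0}})"
        using cls 2 by auto
      ultimately show ?thesis
        unfolding comb using rt 2 e by (simp add: weight_def rank2_def r_max_def r_min_def)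
    next
      case 3
      have "dm_class D = dm_class ({0 :: nat}, {{}, {0}})"
        using dm_class_relabel[OF D, of "\<lambda>_. 0 :: nat"] 3 e by (simp add: relabel_def)
      moreover have "dm_class D \<noteq> dm_class ({0 :: nat}, {{}})" "dm_class D \<noteq> dm_class ({0 :: nat}, {{0}})"
        using cls 3 by auto
      ultimately show ?thesis
        unfolding comb using rt 3 e by (simp add: weight_def rank2_def r_max_def r_min_def)
    qed
  qed
qed

lemma dm_counit_basis:
  fixes D :: "'a set_system"
  assumes D: "delta_matroid D"
  shows "dm_counit (basis (dm_class D)) = (if card (ground D) = 0 then 1 else 0)"
proof -
  have E: "delta_matroid ({} :: nat set, {{}})"
    by (auto simp: delta_matroid_def)
  have "dm_class D = dm_class ({} :: nat set, {{}}) \<longleftrightarrow> ground D = {}"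
  proof
    assume "ground D = {}"
    moreover from this have "feasible D = {{}}"
      using feasible_subset_ground[OF D] delta_matroid_nonempty[OF D] by auto
    ultimately show "dm_class D = dm_class ({} :: nat set, {{}})"
      using dm_class_relabel[OF D, of "\<lambda>_. 0 :: nat"] by (simp add: relabel_def)
  qed (auto simp: dm_class_eq_iff[OF D E] isomorphic_def relabel_def)
  then show ?thesis
    using delta_matroid_finite[OF D] by (simp add: dm_counit_def)
qed

text \<open>
  Only singletons \<open>A\<close> contribute to \<open>f * f\<^sup>n\<close>, and by multiplicativity all \<open>n + 1\<close> of them
  contribute the same amount.
\<close>

lemma conv_power_basis:
  fixes D :: "'a set_system" and s t :: "'k::field_char_0"
  assumes f: "\<And>D :: 'a set_system. delta_matroid D \<Longrightarrow>
      f (basis (dm_class D)) = (if card (ground D) = 1 then weight s t D else 0)"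
    and D: "delta_matroid D"
  shows "conv_power f n (basis (dm_class D)) = (if card (ground D) = n then fact n * weight s t D else 0)"
  using D
proof (induction n arbitrary: D)
  case 0
  have "weight s t D = 1" if "card (ground D) = 0"
    using rank2_le[OF 0] that by (simp add: weight_def)
  then show ?case
    by (simp add: dm_counit_basis[OF 0])
next
  case (Suc n)
  note D = Suc.prems
  have fin: "finite (ground D)"
    using D by (rule delta_matroid_finite)
  have summand: "f (basis (dm_class (dm_delete D (ground D - A)))) *
      conv_power f n (basis (dm_class (dm_contract D A))) =
      (if card A = 1 then if card (ground D) = Suc n then fact n * weight s t D else 0 else 0)"
    if A: "A \<subseteq> ground D" for A
  proof -
    have "card A + card (ground D - A) = card (ground D)"
      using A fin by (simp add: card_Diff_subset card_mono finite_subset)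
    then have "card A = 1 \<Longrightarrow> card (ground D - A) = n \<longleftrightarrow> card (ground D) = Suc n"
      by linarith
    then show ?thesis
      using weight_multiplicative[OF D A, of s t] A D fin finite_subset[OF A fin]
      by (simp add: f Suc.IH delta_matroid_dm_delete delta_matroid_dm_contract double_diff)
  qed
  have "{A \<in> Pow (ground D). card A = 1} = (\<lambda>e. {e}) ` ground D"
    by (auto simp: card_1_singleton_iff)
  then have "card {A \<in> Pow (ground D). card A = 1} = card (ground D)"
    by (simp add: card_image)
  then have count: "(\<Sum>A\<in>Pow (ground D). if card A = 1 then c else 0) = of_nat (card (ground D)) * c" for c :: 'k
    using fin by (simp add: sum.inter_filter[symmetric])
  have "conv_power f (Suc n) (basis (dm_class D)) = (\<Sum>A\<in>Pow (ground D).
      if card A = 1 then if card (ground D) = Suc n then fact n * weight s t D else 0 else 0)"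
    unfolding conv_power.simps conv_basis[OF D] by (intro sum.cong refl summand) simp
  \<comment> \<open>The \<open>Suc n\<close> singletons each contribute \<open>fact n\<close> times
    the weight, which adds up to \<open>fact (Suc n)\<close>.\<close>
  then show ?case
    unfolding count by (simp add: algebra_simps)
qed

text \<open>Only the power k = |E| survives, and its factorial cancels the one in the exponential
  series.\<close>

lemma conv_exp_basis:
  fixes D :: "'a set_system"
  assumes f: "\<And>D :: 'a set_system. delta_matroid D \<Longrightarrow>
      f (basis (dm_class D)) = (if card (ground D) = 1 then weight s t D else 0)"
    and D: "delta_matroid D"
  shows "conv_exp f (basis (dm_class D)) = weight s t D"
proof -
  have "conv_exp f (basis (dm_class D)) =
      (\<Sum>k\<in>{card (ground D)}. conv_power f k (basis (dm_class D)) / fact k)"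
    unfolding conv_exp_def
    by (rule Sum_any.expand_superset) (auto simp: conv_power_basis[OF f D])
  then show ?thesis
    by (simp add: conv_power_basis[OF f D])
qed

section \<open>Half-integral powers and comparison of the two sums over subsets\<close>

lemma two_rho: "2 * rho D = of_nat (rank2 D)"
  by (simp add: rho_def rank2_def)

lemma half_power_nat:
  assumes "2 * q = of_nat n"
  shows "half_power rt x q = rt x ^ n"
  using assms by (simp add: half_power_def)

theorem theorem3p25:
  fixes D :: "'a set \<times> 'a set set"
    and x1 x2 y1 y2 :: "'k::field_char_0"
    and rt :: "'k \<Rightarrow> 'k"
  assumes "delta_matroid D"
    and "x1 \<noteq> 0" and "y2 \<noteq> 0"
    and "rt x1 ^ 2 = x1" and "rt x2 ^ 2 = x2" and "rt y1 ^ 2 = y1" and "rt y2 ^ 2 = y2"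
    and "rt (x1 * x2) = rt x1 * rt x2" and "rt (y1 * y2) = rt y1 * rt y2"
    and "rt (y1 / x1) = rt y1 / rt x1" and "rt (x2 / y2) = rt x2 / rt y2"
  shows "alpha rt (x1, x2) (y1, y2) (basis (dm_class D)) =
      half_power rt x1 (rho D) *
      half_power rt y2 (of_nat (card (ground D)) - rho D) *
      bollobas_riordan rt D (y1 / x1 + 1) (x2 / y2 + 1)"
proof -
  note D = assms(1)
  let ?E = "ground D"
  have fin: "finite ?E"
    using D by (rule delta_matroid_finite)
  have nz: "rt x1 \<noteq> 0" "rt y2 \<noteq> 0"
    using assms by auto
  define S where "S A = dm_delete D (?E - A)" for A
  have alpha: "alpha rt (x1, x2) (y1, y2) (basis (dm_class D)) =
      (\<Sum>A\<in>Pow ?E. weight (rt x1) (rt x2) (S A) * weight (rt y1) (rt y2) (dm_contract D A))"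
  proof -
    have "conv_exp (delta_comb rt x1 x2) (basis (dm_class (S A))) = weight (rt x1) (rt x2) (S A)"
      "conv_exp (delta_comb rt y1 y2) (basis (dm_class (dm_contract D A))) =
        weight (rt y1) (rt y2) (dm_contract D A)" if "A \<subseteq> ?E" for A
      using D fin finite_subset[OF that fin] assms unfolding S_def
      by (intro conv_exp_basis delta_comb_basis delta_matroid_dm_delete delta_matroid_dm_contract; simp)+
    then show ?thesis
      by (simp add: alpha_def conv_basis[OF D] S_def)
  qed
  have summand: "weight (rt x1) (rt x2) (S A) * weight (rt y1) (rt y2) (dm_contract D A) =
      half_power rt x1 (rho D) * half_power rt y2 (of_nat (card ?E) - rho D) *
      (half_power rt (y1 / x1) (rho_set D ?E - rho_set D A) *
       half_power rt (x2 / y2) (of_nat (card A) - rho_set D A))" if A: "A \<subseteq> ?E" for A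
  proof -
    let ?p = "rank2 (S A)" and ?q = "rank2 (dm_contract D A)"
    have finA: "finite A"
      using A fin finite_subset by blast
    have pq: "?p + ?q = rank2 D"
      unfolding S_def by (rule rank2_additive[OF D A])
    have p: "?p \<le> 2 * card A" and q: "?q \<le> 2 * card (?E - A)"
      using rank2_le[of "S A"] rank2_le[of "dm_contract D A"] finA fin D A
      by (simp_all add: S_def delta_matroid_dm_delete delta_matroid_dm_contract double_diff)
    have c: "card A + card (?E - A) = card ?E"
      using A fin finA by (simp add: card_Diff_subset card_mono)
    \<comment> \<open>\<open>p'\<close> and \<open>q'\<close> are the doubled coranks of restriction
      and contraction, introduced to avoid subtraction of natural numbers.\<close>
    obtain p' where p': "2 * card A = ?p + p'"
      using p le_Suc_ex by blast
    obtain q' where q': "2 * card (?E - A) = ?q + q'"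
      using q le_Suc_ex by blast
    have E: "2 * card ?E = ?p + ?q + p' + q'"
      using c p' q' by simp
    have rho_set: "rho_set D B = rho (S B)" if "B \<subseteq> ?E" for B
      using fin D by (simp add: rho_set_def S_def delete_set_eq_dm_delete)
    have rhoE: "rho_set D ?E = rho D"
      by (simp add: rho_set S_def)
    have rat: "2 * rho (S A) = of_nat ?p" "2 * rho D = of_nat ?p + of_nat ?q"
      "2 * of_nat (card A) = (of_nat ?p + of_nat p' :: rat)"
      "2 * of_nat (card ?E) = (of_nat ?p + of_nat ?q + of_nat p' + of_nat q' :: rat)"
      using pq arg_cong[OF p', of "of_nat :: nat \<Rightarrow> rat"] arg_cong[OF E, of "of_nat :: nat \<Rightarrow> rat"]
      by (simp_all add: two_rho flip: pq)
    \<comment> \<open>By rank additivity, 2(\<rho>(E) - \<rho>(A)) is the doubled rank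
      \<open>?q\<close> of the contraction, and 2(|A| - \<rho>(A)) is the doubled corank
      \<open>p'\<close> of the restriction.\<close>
    have "half_power rt x1 (rho D) = rt x1 ^ (?p + ?q)"
      "half_power rt y2 (of_nat (card ?E) - rho D) = rt y2 ^ (p' + q')"
      "half_power rt (y1 / x1) (rho_set D ?E - rho_set D A) = rt (y1 / x1) ^ ?q"
      "half_power rt (x2 / y2) (of_nat (card A) - rho_set D A) = rt (x2 / y2) ^ p'"
      unfolding rhoE rho_set[OF A] using rat by (intro half_power_nat; simp add: algebra_simps)+
    moreover have "weight (rt x1) (rt x2) (S A) = rt x1 ^ ?p * rt x2 ^ p'"
      "weight (rt y1) (rt y2) (dm_contract D A) = rt y1 ^ ?q * rt y2 ^ q'"
      using A p' q' by (simp_all add: weight_def S_def double_diff)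
    \<comment> \<open>The denominators of the two quotients cancel \<open>rt x1 ^ ?q\<close> and
      \<open>rt y2 ^ p'\<close> from the prefactors.\<close>
    ultimately show ?thesis
      using nz assms by (simp add: power_add power_divide field_simps)
  qed
  \<comment> \<open>The shifts by 1 in the arguments cancel against x - 1 and y - 1 in the
    polynomial, so the sums agree term by term.\<close>
  show ?thesis
    unfolding alpha bollobas_riordan_def sum_distrib_left
    by (intro sum.cong refl) (simp add: summand)
qed

end
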